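(* Let $\mathcal{G}_{6,8}$ be the real Lie algebra with basis $x_1,\dots,x_6$ and nonzero brackets $[x_1,x_2]=x_4$, $[x_1,x_4]=x_5$, $[x_2,x_3]=x_5$, $[x_2,x_4]=x_6$. For real $b,c$ with $c\neq0,-1$ let $$J(b,c)=\mathrm{diag}\left(\begin{pmatrix}-\frac bc&-\frac{c^2+b^2}{c^2}\\1&\frac bc\end{pmatrix},\begin{pmatrix}b&-\frac{b^2+1}{c}\\c&-b\end{pmatrix},\begin{pmatrix}0&-\frac{c+1}{c}\\\frac{c}{c+1}&0\end{pmatrix}\right).$$ Then every complex structure on $\mathcal{G}_{6,8}$ is equivalent to some $J(b,c)$ with $c\ne0,-1$, and $J(b,c)$ is equivalent to $J(b',c')$ if and only if $b=b'$ and $c=c'$. The set $\mathfrak{X}_{6,8}$ of all complex structures on $\mathcal{G}_{6,8}$ is a submanifold of dimension 10 of $\mathbb{R}^{36}$, and it is the disjoint union of the $\mathrm{Aut}(\mathcal{G}_{6,8})$-orbits of the $J(b,c)$, $b\in\mathbb{R}$, $c\in\mathbb{R}\setminus\{0,-1\}$.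
   Context: Brackets of basis vectors not listed (and not obtained by antisymmetry) are zero. A complex structure on a real Lie algebra $\mathfrak{g}$ is a linear map $J:\mathfrak{g}\to\mathfrak{g}$ with $J^2=-1$ and $[JX,JY]-[X,Y]-J[JX,Y]-J[X,JY]=0$ for all $X,Y\in\mathfrak{g}$. $J$ is identified with its $6\times 6$ matrix $(\xi^k_j)$ ($k$ the row index, $j$ the column index) in the basis $(x_j)$, i.e. $Jx_j=\sum_k\xi^k_j x_k$; so the set of complex structures is a subset of $\mathbb{R}^{36}$. "Submanifold" means smooth ($C^\infty$) submanifold. $\mathrm{Aut}(\mathfrak{g})$ acts on complex structures by $J\mapsto\Phi^{-1}J\Phi$, and two complex structures are equivalent if they lie in the same orbit. $\mathrm{diag}$ denotes a block-diagonal matrix. *)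

theory Defs
  imports "HOL-Analysis.Analysis"
begin

section \<open>Smooth maps and submanifolds\<close>

text \<open>Continuous differentiability of order \<open>k\<close>; intended for open \<open>S\<close> only.\<close>

primrec C_k_on :: "nat \<Rightarrow> ('a::euclidean_space \<Rightarrow> 'b::euclidean_space) \<Rightarrow> 'a set \<Rightarrow> bool" where
  "C_k_on 0 f S \<longleftrightarrow> continuous_on S f"
| "C_k_on (Suc k) f S \<longleftrightarrow>
     (\<forall>x\<in>S. f differentiable (at x)) \<and>
     (\<forall>v. C_k_on k (\<lambda>x. frechet_derivative f (at x) v) S)"

definition smooth_on :: "('a::euclidean_space \<Rightarrow> 'b::euclidean_space) \<Rightarrow> 'a set \<Rightarrow> bool" where
  "smooth_on f S \<longleftrightarrow> (\<forall>k. C_k_on k f S)"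

definition diffeomorphism_between ::
  "'a::euclidean_space set \<Rightarrow> 'a set \<Rightarrow> ('a \<Rightarrow> 'a) \<Rightarrow> ('a \<Rightarrow> 'a) \<Rightarrow> bool" where
  "diffeomorphism_between U V \<phi> \<psi> \<longleftrightarrow>
     homeomorphism U V \<phi> \<psi> \<and> smooth_on \<phi> U \<and> smooth_on \<psi> V"

text \<open>Embedded submanifolds by slice charts. The coordinate subspace spanned by the \<open>k\<close>
  basis vectors in \<open>B\<close> plays the role of \<open>\<real>\<^sup>k \<times> {0}\<close>.\<close>

definition submanifold :: "nat \<Rightarrow> 'a::euclidean_space set \<Rightarrow> bool" where
  "submanifold k M \<longleftrightarrow>
     (\<forall>p\<in>M. \<exists>U V \<phi> \<psi> B. open U \<and> open V \<and> p \<in> U \<and> diffeomorphism_between U V \<phi> \<psi> \<and>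
        B \<subseteq> Basis \<and> card B = k \<and> \<phi> ` (M \<inter> U) = V \<inter> span B)"

section \<open>Complex structures and automorphisms\<close>

text \<open>A Lie algebra is given by its bracket on coordinate vectors, and endomorphisms are
  matrices \<open>A\<close> acting by \<open>A *v X\<close>, so that \<open>A $ k $ j\<close> is the entry in row \<open>k\<close> and
  column \<open>j\<close>.\<close>

definition complex_structures ::
  "(real^'n \<Rightarrow> real^'n \<Rightarrow> real^'n) \<Rightarrow> (real^'n^'n) set" where
  "complex_structures br =
     {J. J ** J = - mat 1 \<and>
         (\<forall>X Y. br (J *v X) (J *v Y) - br X Y - J *v br (J *v X) Y - J *v br X (J *v Y) = 0)}"

definition Aut :: "(real^'n \<Rightarrow> real^'n \<Rightarrow> real^'n) \<Rightarrow> (real^'n^'n) set" where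
  "Aut br = {\<Phi>. invertible \<Phi> \<and> (\<forall>X Y. \<Phi> *v br X Y = br (\<Phi> *v X) (\<Phi> *v Y))}"

definition orbit ::
  "(real^'n \<Rightarrow> real^'n \<Rightarrow> real^'n) \<Rightarrow> real^'n^'n \<Rightarrow> (real^'n^'n) set" where
  "orbit br J = {matrix_inv \<Phi> ** J ** \<Phi> |\<Phi>. \<Phi> \<in> Aut br}"

definition equivalent ::
  "(real^'n \<Rightarrow> real^'n \<Rightarrow> real^'n) \<Rightarrow> real^'n^'n \<Rightarrow> real^'n^'n \<Rightarrow> bool" where
  "equivalent br J J' \<longleftrightarrow> J' \<in> orbit br J"

section \<open>The Lie algebra and the structures \<open>J(b,c)\<close>\<close>

text \<open>The index type \<open>6\<close> has the elements \<open>1, \<dots>, 5\<close> and \<open>6 = 0\<close>. The basis vector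
  \<open>x\<^sub>i\<close> is \<open>bv i\<close>; the bracket is the bilinear alternating extension of the given ones.\<close>

abbreviation bv :: "6 \<Rightarrow> real^6" where
  "bv i \<equiv> axis i 1"

definition G68 :: "real^6 \<Rightarrow> real^6 \<Rightarrow> real^6" where
  "G68 X Y =
     (X$1 * Y$2 - X$2 * Y$1) *\<^sub>R bv 4
   + (X$1 * Y$4 - X$4 * Y$1) *\<^sub>R bv 5
   + (X$2 * Y$3 - X$3 * Y$2) *\<^sub>R bv 5
   + (X$2 * Y$4 - X$4 * Y$2) *\<^sub>R bv 6"

definition J68 :: "real \<Rightarrow> real \<Rightarrow> real^6^6" where
  "J68 b c = vector [
     vector [- (b/c), - ((c^2 + b^2)/c^2), 0, 0,                0,       0],
     vector [1,       b/c,                 0, 0,                0,       0],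
     vector [0,       0,                   b, - ((b^2 + 1)/c),  0,       0],
     vector [0,       0,                   c, - b,              0,       0],
     vector [0,       0,                   0, 0,                0,       - ((c + 1)/c)],
     vector [0,       0,                   0, 0,                c/(c+1), 0]]"

lemma exhaust_6:
  fixes i :: 6
  shows "i = 1 \<or> i = 2 \<or> i = 3 \<or> i = 4 \<or> i = 5 \<or> i = 6"
proof (induct i)
  case (of_int z)
  then have "z = 0 \<or> z = 1 \<or> z = 2 \<or> z = 3 \<or> z = 4 \<or> z = 5" by fastforce
  then show ?case by auto
qed

lemma vector_6 [simp]:
  "(vector [a,b,c,d,e,f] :: 'a::zero^6)$1 = a"
  "(vector [a,b,c,d,e,f] :: 'a^6)$2 = b"
  "(vector [a,b,c,d,e,f] :: 'a^6)$3 = c"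
  "(vector [a,b,c,d,e,f] :: 'a^6)$4 = d"
  "(vector [a,b,c,d,e,f] :: 'a^6)$5 = e"
  "(vector [a,b,c,d,e,f] :: 'a^6)$6 = f"
  unfolding vector_def by simp_all

lemma G68_basis:
  "G68 (bv 1) (bv 2) = bv 4" "G68 (bv 1) (bv 4) = bv 5"
  "G68 (bv 2) (bv 3) = bv 5" "G68 (bv 2) (bv 4) = bv 6"
  "G68 (bv 1) (bv 3) = 0" "G68 (bv 3) (bv 4) = 0"
  "G68 (bv 5) (bv i) = 0" "G68 (bv 6) (bv i) = 0"
  by (auto simp: G68_def axis_def)

lemma G68_bilinear: "bilinear G68"
  by (auto simp: bilinear_def G68_def algebra_simps intro!: linearI)

lemma G68_antisym: "G68 Y X = - G68 X Y"
  by (simp add: G68_def algebra_simps)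

lemma G68_jacobi: "G68 X (G68 Y Z) + G68 Y (G68 Z X) + G68 Z (G68 X Y) = 0"
  by (simp add: G68_def axis_def vec_eq_iff algebra_simps)

end

theory Submission
  imports Defs
begin

text \<open>Let \<open>J\<close> be a complex structure. If \<open>Z\<close> is central then \<open>ad (J Z)\<close> commutes with \<open>J\<close>; since \<open>J\<close>
  has no real eigenvector, the images of powers of \<open>ad (J Z)\<close> cannot be lines, which forces the centre
  \<open>\<langle>x\<^sub>5, x\<^sub>6\<rangle>\<close> and then the second centre \<open>\<langle>x\<^sub>3, \<dots>, x\<^sub>6\<rangle>\<close> to be \<open>J\<close>-invariant. So \<open>J\<close> is block lower
  triangular, and integrability reduces to the single equation for \<open>(x\<^sub>1, x\<^sub>3)\<close>, which determines the
  block on the centre by the other two diagonal blocks. Together with \<open>J\<^sup>2 = -1\<close> this makes all entries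
  rational functions of ten of them, so the complex structures form a graph over an open set; and an
  explicit automorphism carries each matrix of this graph to some \<open>J(b, c)\<close>. Conversely, an
  automorphism \<open>\<Phi>\<close> has diagonal entries \<open>\<lambda>\<close>, \<open>\<mu>\<close>, \<open>\<lambda>\<^sup>2\<close>, \<open>\<lambda>\<mu>\<close> at \<open>x\<^sub>1, \<dots>, x\<^sub>4\<close>, and its entries
  \<open>(2, 1)\<close> and \<open>(4, 3)\<close> vanish, so comparing entries in \<open>J(b, c) \<Phi> = \<Phi> J(b', c')\<close> recovers \<open>b\<close>
  and \<open>c\<close>.\<close>

section \<open>Smooth maps and graphs\<close>

text \<open>Since \<open>S\<close> is open, the derivative at a point of \<open>S\<close> sees only
  values on \<open>S\<close>, so the directional derivatives of \<open>f\<close> and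
  \<open>g\<close> agree there and the induction passes to them.\<close>

lemma C_k_on_cong:
  assumes "open S" "\<And>x. x \<in> S \<Longrightarrow> f x = g x" "C_k_on k f S"
  shows "C_k_on k g S"
  using assms(2,3)
proof (induction k arbitrary: f g)
  case 0
  then show ?case by (simp cong: continuous_on_cong)
next
  case (Suc k)
  have D: "(g has_derivative frechet_derivative f (at x)) (at x)" if "x \<in> S" for x
  proof (rule has_derivative_transform_within_open[OF _ \<open>open S\<close> that])
    show "(f has_derivative frechet_derivative f (at x)) (at x)"
      using Suc.prems(2) that by (simp add: frechet_derivative_works)
  qed (use Suc.prems in auto)
  have "C_k_on k (\<lambda>x. frechet_derivative g (at x) v) S" for v
    by (rule Suc.IH[where f = "\<lambda>x. frechet_derivative f (at x) v"])
      (use D[THEN frechet_derivative_at] Suc.prems(2) in auto)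
  then show ?case
    using D by (auto simp: differentiable_def)
qed

text \<open>Uniqueness of the derivative allows an explicit \<open>F\<close> in place of the chosen
  \<open>frechet_derivative\<close>; the differentiation rules enter through this lemma.\<close>

lemma C_k_on_SucI:
  assumes "open S" "\<And>x. x \<in> S \<Longrightarrow> (f has_derivative F x) (at x)"
    "\<And>v. C_k_on k (\<lambda>x. F x v) S"
  shows "C_k_on (Suc k) f S"
proof -
  have "C_k_on k (\<lambda>x. frechet_derivative f (at x) v) S" for v
    by (rule C_k_on_cong[OF assms(1) _ assms(3)[of v]])
      (use assms(2)[THEN frechet_derivative_at] in auto)
  then show ?thesis
    using assms(2) by (auto simp: differentiable_def)
qed

lemma C_k_on_has_derivative:
  assumes "C_k_on (Suc k) f S" "x \<in> S"
  shows "(f has_derivative frechet_derivative f (at x)) (at x)"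
  using assms by (simp add: frechet_derivative_works)

lemma C_k_on_SucD:
  assumes "C_k_on (Suc k) f S"
  shows "C_k_on k f S"
  using assms
proof (induction k arbitrary: f)
  case 0
  then show ?case
    by (auto intro!: continuous_at_imp_continuous_on differentiable_imp_continuous_within)
qed auto

lemma C_k_on_const: "open S \<Longrightarrow> C_k_on k (\<lambda>x. c) S"
proof (induction k arbitrary: c)
  case (Suc k)
  then show ?case by (intro C_k_on_SucI[where F = "\<lambda>_ _. 0"]) auto
qed simp

lemma C_k_on_bounded_linear:
  assumes "open S" "bounded_linear L" "C_k_on k f S"
  shows "C_k_on k (\<lambda>x. L (f x)) S"
  using assms(3)
proof (induction k arbitrary: f)
  case 0
  then show ?case by (simp add: bounded_linear.continuous_on[OF assms(2)])
next
  case (Suc k)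
  show ?case
  proof (rule C_k_on_SucI[OF assms(1)])
    show "((\<lambda>x. L (f x)) has_derivative (\<lambda>v. L (frechet_derivative f (at x) v))) (at x)"
      if "x \<in> S" for x
      using bounded_linear.has_derivative[OF assms(2) C_k_on_has_derivative[OF Suc.prems that]] .
  qed (use Suc in auto)
qed

lemma C_k_on_id: "open S \<Longrightarrow> C_k_on k (\<lambda>x. x) S"
proof (induction k)
  case (Suc k)
  then show ?case by (intro C_k_on_SucI[where F = "\<lambda>_ v. v"]) (auto intro: C_k_on_const)
qed simp

lemma C_k_on_add:
  assumes "open S" "C_k_on k f S" "C_k_on k g S"
  shows "C_k_on k (\<lambda>x. f x + g x) S"
  using assms(2,3)
proof (induction k arbitrary: f g)
  case (Suc k)
  show ?case
    by (rule C_k_on_SucI[OF assms(1) has_derivative_add[OF C_k_on_has_derivative C_k_on_has_derivative]])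
      (use Suc in auto)
qed (simp add: continuous_on_add)

text \<open>The product rule leaves one factor undifferentiated, so the induction also needs
  \<open>f\<close> and \<open>g\<close> themselves at the lower order.\<close>

lemma C_k_on_mult:
  fixes f g :: "'a::euclidean_space \<Rightarrow> real"
  assumes "open S" "C_k_on k f S" "C_k_on k g S"
  shows "C_k_on k (\<lambda>x. f x * g x) S"
  using assms(2,3)
proof (induction k arbitrary: f g)
  case (Suc k)
  have "C_k_on k f S" "C_k_on k g S"
    using Suc.prems by (blast intro: C_k_on_SucD)+
  then show ?case
    by (intro C_k_on_SucI[OF assms(1) has_derivative_mult[OF C_k_on_has_derivative C_k_on_has_derivative]]
        C_k_on_add assms(1) Suc.IH)
      (use Suc.prems in auto)
qed (simp add: continuous_on_mult)

text \<open>The derivative of 1/f contains 1/f again, whose regularity at the lower order is the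
  induction hypothesis.\<close>

lemma C_k_on_inverse:
  fixes f :: "'a::euclidean_space \<Rightarrow> real"
  assumes "open S" "C_k_on k f S" "\<And>x. x \<in> S \<Longrightarrow> f x \<noteq> 0"
  shows "C_k_on k (\<lambda>x. inverse (f x)) S"
  using assms(2)
proof (induction k)
  case 0
  then show ?case using assms(3) by (simp add: continuous_on_inverse)
next
  case (Suc k)
  then have I: "C_k_on k (\<lambda>x. inverse (f x)) S"
    by (blast intro: C_k_on_SucD)
  show ?case
  proof (rule C_k_on_SucI[OF assms(1) Deriv.has_derivative_inverse[OF _ C_k_on_has_derivative[OF Suc.prems]]])
    show "C_k_on k (\<lambda>x. - (inverse (f x) * frechet_derivative f (at x) v * inverse (f x))) S" for v
      using Suc.prems by (intro C_k_on_bounded_linear[where L = uminus] bounded_linear_minus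
          bounded_linear_ident C_k_on_mult assms(1) I) auto
  qed (use assms(3) in auto)
qed

lemma C_k_on_componentwise:
  assumes "open S" "\<And>b. b \<in> Basis \<Longrightarrow> C_k_on k (\<lambda>x. f x \<bullet> b) S"
  shows "C_k_on k f S"
proof -
  have "C_k_on k (\<lambda>x. \<Sum>b\<in>B. (f x \<bullet> b) *\<^sub>R b) S" if "B \<subseteq> Basis" for B
    using finite_subset[OF that finite_Basis] that
  proof (induction B rule: finite_induct)
    case (insert b B)
    then show ?case
      using C_k_on_bounded_linear[OF assms(1) bounded_linear_scaleR_left assms(2)]
      by (auto intro!: C_k_on_add assms(1))
  qed (simp add: C_k_on_const assms(1))
  from this[of Basis] show ?thesis
    by (simp add: euclidean_representation)
qed

lemma smooth_on_const: "open S \<Longrightarrow> smooth_on (\<lambda>x. c) S"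
  by (simp add: smooth_on_def C_k_on_const)

lemma smooth_on_id: "open S \<Longrightarrow> smooth_on (\<lambda>x. x) S"
  by (simp add: smooth_on_def C_k_on_id)

lemma smooth_on_bounded_linear:
  "open S \<Longrightarrow> bounded_linear L \<Longrightarrow> smooth_on f S \<Longrightarrow> smooth_on (\<lambda>x. L (f x)) S"
  by (simp add: smooth_on_def C_k_on_bounded_linear)

lemma smooth_on_add:
  "open S \<Longrightarrow> smooth_on f S \<Longrightarrow> smooth_on g S \<Longrightarrow> smooth_on (\<lambda>x. f x + g x) S"
  by (simp add: smooth_on_def C_k_on_add)

lemma smooth_on_minus: "open S \<Longrightarrow> smooth_on f S \<Longrightarrow> smooth_on (\<lambda>x. - f x) S"
  by (intro smooth_on_bounded_linear[where L = uminus] bounded_linear_minus bounded_linear_ident)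

lemma smooth_on_diff:
  "open S \<Longrightarrow> smooth_on f S \<Longrightarrow> smooth_on g S \<Longrightarrow> smooth_on (\<lambda>x. f x - g x) S"
  using smooth_on_add[OF _ _ smooth_on_minus, of S f g] by simp

lemma smooth_on_mult:
  fixes f g :: "'a::euclidean_space \<Rightarrow> real"
  shows "open S \<Longrightarrow> smooth_on f S \<Longrightarrow> smooth_on g S \<Longrightarrow> smooth_on (\<lambda>x. f x * g x) S"
  by (simp add: smooth_on_def C_k_on_mult)

lemma smooth_on_divide:
  fixes f g :: "'a::euclidean_space \<Rightarrow> real"
  shows "open S \<Longrightarrow> smooth_on f S \<Longrightarrow> smooth_on g S \<Longrightarrow> (\<And>x. x \<in> S \<Longrightarrow> g x \<noteq> 0) \<Longrightarrow>
    smooth_on (\<lambda>x. f x / g x) S"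
  by (simp add: smooth_on_def divide_inverse C_k_on_mult C_k_on_inverse)

lemma smooth_on_componentwise:
  "open S \<Longrightarrow> (\<And>b. b \<in> Basis \<Longrightarrow> smooth_on (\<lambda>x. f x \<bullet> b) S) \<Longrightarrow> smooth_on f S"
  by (simp add: smooth_on_def C_k_on_componentwise)

lemma smooth_on_continuous: "smooth_on f S \<Longrightarrow> continuous_on S f"
  unfolding smooth_on_def by (metis C_k_on.simps(1))

section \<open>Graphs over coordinate subspaces\<close>

lemma mem_span_subset_Basis:
  fixes x :: "'a::euclidean_space"
  assumes "B \<subseteq> Basis"
  shows "x \<in> span B \<longleftrightarrow> (\<forall>b\<in>Basis - B. x \<bullet> b = 0)"
  using span_substd_basis[OF assms] by blast

text \<open>The set is the graph of \<open>h\<close> over \<open>span B\<close>; the shear \<open>x \<mapsto> x - h x\<close>, with inverse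
  \<open>x \<mapsto> x + h x\<close>, is a single slice chart for all of it.\<close>

lemma submanifold_graph:
  fixes h :: "'a::euclidean_space \<Rightarrow> 'a"
  assumes "open U" "smooth_on h U" "B \<subseteq> Basis" "card B = k"
    and h0: "\<And>x b. b \<in> B \<Longrightarrow> h x \<bullet> b = 0"
    and U: "\<And>x y. (\<And>b. b \<in> B \<Longrightarrow> x \<bullet> b = y \<bullet> b) \<Longrightarrow> x \<in> U \<Longrightarrow> y \<in> U"
    and h: "\<And>x y. (\<And>b. b \<in> B \<Longrightarrow> x \<bullet> b = y \<bullet> b) \<Longrightarrow> h x = h y"
  shows "submanifold k {x \<in> U. x - h x \<in> span B}"
proof -
  define \<phi> where "\<phi> = (\<lambda>x. x - h x)"
  define \<psi> where "\<psi> = (\<lambda>x. x + h x)"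
  \<comment> \<open>\<open>h\<close> depends only on the coordinates in \<open>B\<close>, and its
    own coordinates there are zero. So adding or subtracting \<open>h x\<close> does not change the
    value of \<open>h\<close>, and the two shears are mutually inverse.\<close>
  have hh: "h (x - h x) = h x" "h (x + h x) = h x" for x
    by (rule h; simp add: inner_diff_left inner_add_left h0)+
  have inU: "x - h x \<in> U" "x + h x \<in> U" if "x \<in> U" for x
    by (rule U[OF _ that]; simp add: inner_diff_left inner_add_left h0)+
  have sm: "smooth_on \<phi> U" "smooth_on \<psi> U"
    unfolding \<phi>_def \<psi>_def using assms(1,2)
    by (auto intro: smooth_on_add smooth_on_diff smooth_on_id)
  have "homeomorphism U U \<phi> \<psi>"
    by (rule homeomorphismI)
      (use sm inU in \<open>auto simp: smooth_on_continuous, auto simp: \<phi>_def \<psi>_def hh\<close>)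
  then have diffeo: "diffeomorphism_between U U \<phi> \<psi>"
    using sm by (simp add: diffeomorphism_between_def)
  have "\<phi> ` ({x \<in> U. x - h x \<in> span B} \<inter> U) = U \<inter> span B"
  proof (intro equalityI subsetI)
    fix y assume "y \<in> U \<inter> span B"
    then show "y \<in> \<phi> ` ({x \<in> U. x - h x \<in> span B} \<inter> U)"
      by (intro image_eqI[where x = "\<psi> y"]) (auto simp: \<phi>_def \<psi>_def hh inU)
  qed (auto simp: \<phi>_def inU)
  then show ?thesis
    unfolding submanifold_def using assms(1,3,4) diffeo by blast
qed

section \<open>Orbits of complex structures\<close>

text \<open>An intertwining relation is free of inverses, so for explicit matrices it can be
  compared entry by entry.\<close>

lemma mem_orbit_iff: "K \<in> orbit br J \<longleftrightarrow> (\<exists>\<Phi>\<in>Aut br. J ** \<Phi> = \<Phi> ** K)"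
proof -
  have "K = matrix_inv \<Phi> ** J ** \<Phi> \<longleftrightarrow> J ** \<Phi> = \<Phi> ** K" if "\<Phi> \<in> Aut br" for \<Phi>
  proof -
    have i: "matrix_inv \<Phi> ** \<Phi> = mat 1" "\<Phi> ** matrix_inv \<Phi> = mat 1"
      using that by (auto simp: Aut_def invertible_def matrix_inv_def intro: someI2_ex)
    have "\<Phi> ** (matrix_inv \<Phi> ** J ** \<Phi>) = J ** \<Phi>" "matrix_inv \<Phi> ** (\<Phi> ** K) = K"
      by (simp_all add: matrix_mul_assoc i)
    then show ?thesis
      by (metis matrix_mul_assoc)
  qed
  then show ?thesis
    by (auto simp: orbit_def)
qed

lemma Aut_mult: "\<Phi> \<in> Aut br \<Longrightarrow> \<Psi> \<in> Aut br \<Longrightarrow> \<Phi> ** \<Psi> \<in> Aut br"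
  by (simp add: Aut_def invertible_mult flip: matrix_vector_mul_assoc)

lemma Aut_inverse:
  assumes "\<Phi> \<in> Aut br"
  obtains \<Psi> where "\<Psi> \<in> Aut br" "\<Phi> ** \<Psi> = mat 1" "\<Psi> ** \<Phi> = mat 1"
proof -
  obtain \<Psi> where i: "\<Phi> ** \<Psi> = mat 1" "\<Psi> ** \<Phi> = mat 1"
    using assms by (auto simp: Aut_def invertible_def)
  have v: "\<Phi> *v (\<Psi> *v X) = X" "\<Psi> *v (\<Phi> *v X) = X" for X
    by (simp_all add: matrix_vector_mul_assoc i)
  have br: "\<Phi> *v br X Y = br (\<Phi> *v X) (\<Phi> *v Y)" for X Y
    using assms by (simp add: Aut_def)
  have "\<Psi> *v br X Y = br (\<Psi> *v X) (\<Psi> *v Y)" for X Y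
    using br[of "\<Psi> *v X" "\<Psi> *v Y"] v by metis
  then have "\<Psi> \<in> Aut br"
    using i by (auto simp: Aut_def invertible_def)
  with i show thesis using that by blast
qed

lemma orbit_refl: "J \<in> orbit br J"
proof -
  have "mat 1 \<in> Aut br"
    by (simp add: Aut_def) (metis invertible_def matrix_mul_lid)
  then show ?thesis
    unfolding mem_orbit_iff by (rule rev_bexI) simp
qed

lemma orbit_sym:
  assumes "K \<in> orbit br J"
  shows "J \<in> orbit br K"
proof -
  obtain \<Phi> where "\<Phi> \<in> Aut br" and J: "J ** \<Phi> = \<Phi> ** K"
    using assms by (auto simp: mem_orbit_iff)
  then obtain \<Psi> where \<Psi>: "\<Psi> \<in> Aut br" "\<Phi> ** \<Psi> = mat 1" "\<Psi> ** \<Phi> = mat 1"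
    by (blast elim: Aut_inverse)
  have "K ** \<Psi> = \<Psi> ** (\<Phi> ** K) ** \<Psi>"
    by (simp add: matrix_mul_assoc \<Psi>)
  also have "\<dots> = \<Psi> ** J"
    unfolding J[symmetric] by (simp add: \<Psi> flip: matrix_mul_assoc)
  finally show ?thesis
    using \<Psi>(1) by (auto simp: mem_orbit_iff)
qed

lemma orbit_trans:
  assumes "K \<in> orbit br J" "L \<in> orbit br K"
  shows "L \<in> orbit br J"
  using assms unfolding mem_orbit_iff by (metis Aut_mult matrix_mul_assoc)

text \<open>An automorphism that intertwines \<open>K\<close> with \<open>J\<close> carries both
  defining expressions of \<open>K\<close> to those of \<open>J\<close>, and it is
  injective.\<close>

lemma orbit_subset_complex_structures:
  assumes J: "J \<in> complex_structures br"
  shows "orbit br J \<subseteq> complex_structures br"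
proof
  fix K assume "K \<in> orbit br J"
  then obtain \<Phi> where \<Phi>: "\<Phi> \<in> Aut br" and JK: "J ** \<Phi> = \<Phi> ** K"
    by (auto simp: mem_orbit_iff)
  from \<Phi> obtain \<Psi> where \<Psi>: "\<Psi> ** \<Phi> = mat 1"
    by (blast elim: Aut_inverse)
  have inj: "X = Y" if "\<Phi> *v X = \<Phi> *v Y" for X Y
    using that by (metis \<Psi> matrix_vector_mul_assoc matrix_vector_mul_lid)
  have JK': "\<Phi> *v (K *v X) = J *v (\<Phi> *v X)" for X
    by (simp add: matrix_vector_mul_assoc JK)
  have br: "\<Phi> *v br X Y = br (\<Phi> *v X) (\<Phi> *v Y)" for X Y
    using \<Phi> by (simp add: Aut_def)
  have sq: "J ** J = - mat 1"
    and N: "\<And>X Y. br (J *v X) (J *v Y) - br X Y - J *v br (J *v X) Y - J *v br X (J *v Y) = 0"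
    using J by (auto simp: complex_structures_def)
  have "K ** K = - mat 1"
  proof -
    have m: "- mat 1 *v X = - X" for X :: "real^'a"
      using matrix_vector_mult_diff_rdistrib[of 0 "mat 1" X] by simp
    have J2: "J *v (J *v X) = - X" for X
      by (simp add: matrix_vector_mul_assoc sq m)
    have "(K ** K) *v X = - mat 1 *v X" for X
      by (rule inj) (simp add: m JK' J2 linear_neg flip: matrix_vector_mul_assoc)
    then show ?thesis
      by (simp add: matrix_eq)
  qed
  moreover have "br (K *v X) (K *v Y) - br X Y - K *v br (K *v X) Y - K *v br X (K *v Y) = 0" for X Y
    by (rule inj) (simp add: matrix_vector_mult_diff_distrib JK' br N)
  ultimately show "K \<in> complex_structures br"
    by (simp add: complex_structures_def)
qed

text \<open>Bilinearity reduces integrability to pairs of basis vectors.\<close>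

lemma bilinear_nijenhuis:
  fixes br :: "real^'n \<Rightarrow> real^'n \<Rightarrow> real^'n"
  assumes "bilinear br"
  shows "bilinear (\<lambda>X Y. br (J *v X) (J *v Y) - br X Y - J *v br (J *v X) Y - J *v br X (J *v Y))"
  unfolding bilinear_def
  by (intro conjI allI linearI;
      simp add: bilinear_ladd[OF assms] bilinear_radd[OF assms] bilinear_lmul[OF assms]
        bilinear_rmul[OF assms] matrix_vector_right_distrib matrix_vector_mult_scaleR algebra_simps)

section \<open>Six-dimensional matrices\<close>

lemma UNIV_6: "(UNIV :: 6 set) = {1, 2, 3, 4, 5, 6}"
proof -
  have "i \<in> {1, 2, 3, 4, 5, 6}" for i :: 6
    using exhaust_6[of i] by blast
  then show ?thesis by blast
qed

lemma sum_6: "sum f (UNIV :: 6 set) = f 1 + f 2 + f 3 + f 4 + f 5 + f 6"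
  unfolding UNIV_6 by (simp add: add.assoc)

lemma forall_6: "(\<forall>i::6. P i) \<longleftrightarrow> P 1 \<and> P 2 \<and> P 3 \<and> P 4 \<and> P 5 \<and> P 6"
  using exhaust_6 by (metis (full_types))

text \<open>A real eigenvalue would have square -1. The factor \<open>\<kappa>\<close> fits
  equations in which a multiple of \<open>J *v v\<close> is obtained.\<close>

lemma square_minus_one_no_eigenvector:
  fixes J :: "real^'n^'n"
  assumes "J ** J = - mat 1" "\<kappa> *\<^sub>R (J *v v) = \<mu> *\<^sub>R v" "\<kappa> \<noteq> 0"
  shows "v = 0"
proof -
  define \<nu> where "\<nu> = \<mu> / \<kappa>"
  have "J *v v = inverse \<kappa> *\<^sub>R (\<kappa> *\<^sub>R (J *v v))"
    using assms(3) by simp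
  then have Jv: "J *v v = \<nu> *\<^sub>R v"
    unfolding assms(2) by (simp add: \<nu>_def field_simps)
  have "J *v (J *v v) = - v"
    using matrix_vector_mult_diff_rdistrib[of 0 "mat 1" v] by (simp add: matrix_vector_mul_assoc assms(1))
  then have "(\<nu> * \<nu>) *\<^sub>R v = - v"
    by (simp add: Jv matrix_vector_mult_scaleR)
  then have "(\<nu> * \<nu> + 1) *\<^sub>R v = 0"
    by (simp add: scaleR_left_distrib)
  moreover have "\<nu> * \<nu> + 1 \<noteq> 0"
    using zero_le_square[of \<nu>] by linarith
  ultimately show ?thesis by simp
qed

lemma matrix_vector_mult_6:
  fixes A :: "real^6^6"
  shows "(A *v X) $ k = A$k$1 * X$1 + A$k$2 * X$2 + A$k$3 * X$3 + A$k$4 * X$4 + A$k$5 * X$5 + A$k$6 * X$6"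
  by (simp add: matrix_vector_mult_def sum_6)

lemma matrix_matrix_mult_6:
  fixes A B :: "real^6^6"
  shows "(A ** B) $ k $ j = A$k$1 * B$1$j + A$k$2 * B$2$j + A$k$3 * B$3$j
    + A$k$4 * B$4$j + A$k$5 * B$5$j + A$k$6 * B$6$j"
  by (simp add: matrix_matrix_mult_def sum_6)

lemma G68_nth:
  "G68 X Y $ 1 = 0" "G68 X Y $ 2 = 0" "G68 X Y $ 3 = 0"
  "G68 X Y $ 4 = X$1 * Y$2 - X$2 * Y$1"
  "G68 X Y $ 5 = X$1 * Y$4 - X$4 * Y$1 + X$2 * Y$3 - X$3 * Y$2"
  "G68 X Y $ 6 = X$2 * Y$4 - X$4 * Y$2"
  by (simp_all add: G68_def axis_def)

lemma bv_nth: "bv i $ k = (if k = i then 1 else 0)"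
  by (simp add: axis_def)

lemma matrix_vector_mult_bv: "(A *v bv i) $ k = A $ k $ i"
  by (simp add: matrix_vector_mult_basis column_def)

section \<open>Complex structures on \<open>G68\<close>\<close>

lemma J68_square:
  assumes "c \<noteq> 0" "c + 1 \<noteq> 0"
  shows "J68 b c ** J68 b c = - mat 1"
  using assms by (simp add: vec_eq_iff matrix_matrix_mult_6 mat_def J68_def forall_6)
    (simp add: field_simps power2_eq_square)

lemma J68_nijenhuis:
  fixes b c :: real
  assumes "c \<noteq> 0" "c + 1 \<noteq> 0"
  defines "J \<equiv> J68 b c"
  shows "G68 (J *v X) (J *v Y) - G68 X Y - J *v G68 (J *v X) Y - J *v G68 X (J *v Y) = 0"
proof -
  have "(\<lambda>X Y. G68 (J *v X) (J *v Y) - G68 X Y - J *v G68 (J *v X) Y - J *v G68 X (J *v Y))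
      = (\<lambda>X Y. 0)"
  proof (rule bilinear_eq_stdbasis[OF bilinear_nijenhuis[OF G68_bilinear]])
    show "bilinear (\<lambda>X Y. 0 :: real^6)"
      by (auto simp: bilinear_def intro: linearI)
    \<comment> \<open>Expanded forms of c^n (c + 1) for n = 1, 2, 3, shown to be nonzero in
      preparation for clearing denominators.\<close>
    have "c + c * c = c * (c + 1)" "c * c + c * (c * c) = c * c * (c + 1)"
      "c * (c * c) + c * (c * (c * c)) = c * c * c * (c + 1)"
      by algebra+
    then have "c + c * c \<noteq> 0" "c * c + c * (c * c) \<noteq> 0" "c * (c * c) + c * (c * (c * c)) \<noteq> 0"
      using assms(1,2) by auto
    then have "\<forall>i j. G68 (J *v bv i) (J *v bv j) - G68 (bv i) (bv j)
        - J *v G68 (J *v bv i) (bv j) - J *v G68 (bv i) (J *v bv j) = 0"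
      unfolding forall_6 using assms(1,2)
      by (simp add: vec_eq_iff forall_6 G68_nth matrix_vector_mult_6 bv_nth J_def J68_def)
        (simp add: field_simps power2_eq_square)
    then show "G68 (J *v u) (J *v v) - G68 u v - J *v G68 (J *v u) v - J *v G68 u (J *v v) = 0"
      if "u \<in> Basis" "v \<in> Basis" for u v
      using that by (auto simp: Basis_vec_def)
  qed
  from fun_cong[OF fun_cong[OF this]] show ?thesis .
qed

text \<open>Put W = J x_i. As x_i is central, integrability says that ad W commutes with J, so J
  preserves the images of ad W and of its square. The coordinates of W are eliminated in the order
  (1, 2), 4, 3.\<close>

lemma center_invariant:
  assumes J: "J \<in> complex_structures G68" and i: "i = 5 \<or> i = 6" and k: "k \<in> {1, 2, 3, 4}"
  shows "J $ k $ i = 0"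
proof -
  have sq: "J ** J = - mat 1"
    and N: "\<And>X Y. G68 (J *v X) (J *v Y) - G68 X Y - J *v G68 (J *v X) Y - J *v G68 X (J *v Y) = 0"
    using J by (auto simp: complex_structures_def)
  note eig = square_minus_one_no_eigenvector[OF sq]
  define W where "W = J *v bv i"
  have z: "G68 (bv i) Y = 0" for Y
    using i by (auto simp: vec_eq_iff forall_6 G68_nth bv_nth)
  have comm: "J *v G68 W Y = G68 W (J *v Y)" for Y
    using N[of "bv i" Y] by (simp add: z W_def)
  \<comment> \<open>The square of ad W has its image in the line of \<open>v\<close>. If
    \<open>v\<close> were nonzero, this line would be the image, and \<open>v\<close> an eigenvector
    of J.\<close>
  define v where "v = W$1 *\<^sub>R bv 5 + W$2 *\<^sub>R bv 6"
  have L2: "G68 W (G68 W Y) = (W$1 * Y$2 - W$2 * Y$1) *\<^sub>R v" for Y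
    by (simp add: vec_eq_iff forall_6 G68_nth bv_nth v_def algebra_simps)
  have Jv: "(W$1 * Y$2 - W$2 * Y$1) *\<^sub>R (J *v v) = (W$1 * (J *v Y)$2 - W$2 * (J *v Y)$1) *\<^sub>R v" for Y
    unfolding L2[symmetric] comm[symmetric] by (simp add: L2 matrix_vector_mult_scaleR)
  have "v = 0"
  proof (rule ccontr)
    assume "v \<noteq> 0"
    then have "W$1 \<noteq> 0 \<or> W$2 \<noteq> 0" by (auto simp: v_def)
    then obtain Y :: "real^6" where Y: "W$1 * Y$2 - W$2 * Y$1 \<noteq> 0"
    proof
      assume "W$1 \<noteq> 0"
      then show thesis by (intro that[of "bv 2"]) (simp add: bv_nth)
    next
      assume "W$2 \<noteq> 0"
      then show thesis by (intro that[of "bv 1"]) (simp add: bv_nth)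
    qed
    from eig[OF Jv Y] \<open>v \<noteq> 0\<close> show False by simp
  qed
  then have W12: "W$1 = 0" "W$2 = 0"
    by (auto simp: v_def vec_eq_iff forall_6 bv_nth)
  have adW: "G68 W Y = (- W$4 * Y$1 - W$3 * Y$2) *\<^sub>R bv 5 - (W$4 * Y$2) *\<^sub>R bv 6" for Y
    by (simp add: vec_eq_iff forall_6 G68_nth bv_nth W12)
  \<comment> \<open>Otherwise ad W maps x_1 and x_2 to a basis of the centre. Then J maps the centre
    into the image of ad W, where the x_4-coordinate is zero, although J x_i = W has a nonzero
    one.\<close>
  have W4: "W$4 = 0"
  proof (rule ccontr)
    assume "W$4 \<noteq> 0"
    have "(J *v G68 W Y) $ 4 = 0" for Y
      by (simp add: comm G68_nth W12)
    from this[of "bv 1"] this[of "bv 2"] \<open>W$4 \<noteq> 0\<close> have "J$4$5 = 0" "J$4$6 = 0"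
      by (auto simp: adW bv_nth matrix_vector_mult_6)
    with \<open>W$4 \<noteq> 0\<close> i show False
      by (auto simp: W_def matrix_vector_mult_bv)
  qed
  \<comment> \<open>Now the image of ad W lies in the line of x_5, so x_5 would be an eigenvector of
    J.\<close>
  have W3: "W$3 = 0"
  proof (rule ccontr)
    assume "W$3 \<noteq> 0"
    have "(- W$3) *\<^sub>R (J *v bv 5) = (- W$3 * (J *v bv 2)$2) *\<^sub>R bv 5"
      using comm[of "bv 2"] by (simp add: adW bv_nth W4 flip: matrix_vector_mult_scaleR)
    from eig[OF this] \<open>W$3 \<noteq> 0\<close> show False by (simp add: axis_eq_0_iff)
  qed
  show ?thesis
    using W12 W3 W4 k by (auto simp: W_def matrix_vector_mult_bv)
qed

text \<open>Brackets lie in the span of x_4, x_5, x_6, and those with x_3 or x_4 have no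
  x_4-coordinate. As the centre is invariant, rows 1 to 3 of the integrability condition retain only
  the x_4-coordinate of [J x_j, Y] times column 4 of J.\<close>

lemma second_center_invariant:
  assumes J: "J \<in> complex_structures G68" and j: "j = 3 \<or> j = 4" and k: "k = 1 \<or> k = 2"
  shows "J $ k $ j = 0"
proof -
  have sq: "J ** J = - mat 1"
    and N: "\<And>X Y. G68 (J *v X) (J *v Y) - G68 X Y - J *v G68 (J *v X) Y - J *v G68 X (J *v Y) = 0"
    using J by (auto simp: complex_structures_def)
  note Z = center_invariant[OF J]
  have "(J ** J) $ 4 $ 4 = -1"
    by (simp add: sq mat_def)
  \<comment> \<open>If all three were zero, the entry (4, 4) of J^2 would be the square of
    \<open>J$4$4\<close>.\<close>
  then have V: "J$1$4 \<noteq> 0 \<or> J$2$4 \<noteq> 0 \<or> J$3$4 \<noteq> 0"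
    using zero_le_square[of "J$4$4"] by (auto simp: matrix_matrix_mult_6 Z simp del: zero_le_square)
  have Nj: "(G68 (J *v bv j) (J *v Y) - G68 (bv j) Y - J *v G68 (J *v bv j) Y
      - J *v G68 (bv j) (J *v Y)) $ i = 0" for Y i
    by (simp add: N)
  have "J$i$4 * (J$1$j * Y$2 - J$2$j * Y$1) = 0" if "i = 1 \<or> i = 2 \<or> i = 3"
    for Y :: "real^6" and i
    using Nj[of Y i] j that by (auto simp: matrix_vector_mult_6[of J "G68 _ _"] G68_nth Z bv_nth matrix_vector_mult_bv)
  from this[of _ "bv 2"] this[of _ "bv 1"] have "J$1$j = 0" "J$2$j = 0"
    using V by (auto simp: bv_nth)
  then show ?thesis using k by auto
qed

text \<open>The \<open>2 \<times> 2\<close> blocks on \<open>\<langle>x\<^sub>1, x\<^sub>2\<rangle>\<close>, \<open>\<langle>x\<^sub>3, x\<^sub>4\<rangle>\<close>, \<open>\<langle>x\<^sub>5, x\<^sub>6\<rangle>\<close> have \<open>(\<alpha>, 1)\<close>,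
  \<open>(\<beta>, 1)\<close>, \<open>(\<alpha> + \<beta>, 1)\<close> as eigenvectors for \<open>\<i>\<close>, where \<open>\<alpha> = (a + \<i>)/c\<close> and \<open>\<beta> = (b + \<i>)/d\<close>.\<close>

definition normal_matrix ::
  "real \<Rightarrow> real \<Rightarrow> real \<Rightarrow> real \<Rightarrow> real \<Rightarrow> real \<Rightarrow> real \<Rightarrow> real \<Rightarrow> real \<Rightarrow> real \<Rightarrow> real^6^6" where
  "normal_matrix a c b d p\<^sub>3 p\<^sub>4 q\<^sub>5 q\<^sub>6 r\<^sub>5 r\<^sub>6 =
    (let e = (a * d + b * c) / (c + d); f = c * d / (c + d);
         u = - ((a^2 + 1) / c); v = - ((b^2 + 1) / d); w = - ((e^2 + 1) / f);
         p\<^sub>3' = - (((a + b) * p\<^sub>3 + v * p\<^sub>4) / c); p\<^sub>4' = - ((d * p\<^sub>3 + (a - b) * p\<^sub>4) / c);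
         q\<^sub>5' = - (((b + e) * q\<^sub>5 + w * q\<^sub>6) / d); q\<^sub>6' = - ((f * q\<^sub>5 + (b - e) * q\<^sub>6) / d);
         r\<^sub>5' = - ((q\<^sub>5 * p\<^sub>3 + q\<^sub>5' * p\<^sub>4 + (a + e) * r\<^sub>5 + w * r\<^sub>6) / c);
         r\<^sub>6' = - ((q\<^sub>6 * p\<^sub>3 + q\<^sub>6' * p\<^sub>4 + f * r\<^sub>5 + (a - e) * r\<^sub>6) / c)
     in vector [
       vector [a, u, 0, 0, 0, 0],
       vector [c, - a, 0, 0, 0, 0],
       vector [p\<^sub>3, p\<^sub>3', b, v, 0, 0],
       vector [p\<^sub>4, p\<^sub>4', d, - b, 0, 0],
       vector [r\<^sub>5, r\<^sub>5', q\<^sub>5, q\<^sub>5', e, w],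
       vector [r\<^sub>6, r\<^sub>6', q\<^sub>6, q\<^sub>6', f, - e]])"

text \<open>Rebuilds a matrix from ten of its entries; the complex structures will be its fixed
  points in \<open>chart_domain\<close>.\<close>

definition normal_form_of :: "real^6^6 \<Rightarrow> real^6^6" where
  "normal_form_of J = normal_matrix (J$1$1) (J$2$1) (J$3$3) (J$4$3)
     (J$3$1) (J$4$1) (J$5$3) (J$6$3) (J$5$1) (J$6$1)"

text \<open>These are the denominators \<open>c\<close>, \<open>d\<close>, \<open>c + d\<close> of
  \<open>normal_matrix\<close>; its remaining denominator \<open>f\<close> is then nonzero as
  well.\<close>

definition chart_domain :: "(real^6^6) set" where
  "chart_domain = {J. J$2$1 \<noteq> 0 \<and> J$4$3 \<noteq> 0 \<and> J$2$1 + J$4$3 \<noteq> 0}"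

text \<open>By invariance J is block lower triangular. The relations \<open>A\<close> to
  \<open>F\<close> are entries of J^2 = -1 in columns 1, 3, 5 and are solved for columns 2, 4, 6;
  \<open>G\<close> supplies \<open>J$5$5\<close> and \<open>J$6$5\<close>.\<close>

lemma complex_structure_normal:
  assumes J: "J \<in> complex_structures G68"
  shows "J \<in> chart_domain" "J = normal_form_of J"
proof -
  have sq: "J ** J = - mat 1"
    and N: "\<And>X Y. G68 (J *v X) (J *v Y) - G68 X Y - J *v G68 (J *v X) Y - J *v G68 X (J *v Y) = 0"
    using J by (auto simp: complex_structures_def)
  note Z = center_invariant[OF J] second_center_invariant[OF J]
  have sq': "(J ** J) $ i $ j = (if i = j then -1 else 0)" for i j
    by (simp add: sq mat_def)
  have no: "x * x \<noteq> -1" for x :: real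
    using zero_le_square[of x] by linarith
  have A: "J$1$1 * J$1$1 + J$1$2 * J$2$1 = -1" "J$2$1 * (J$1$1 + J$2$2) = 0"
    using sq'[of 1 1] sq'[of 2 1] by (simp_all add: matrix_matrix_mult_6 Z algebra_simps)
  have B: "J$3$3 * J$3$3 + J$3$4 * J$4$3 = -1" "J$4$3 * (J$3$3 + J$4$4) = 0"
    using sq'[of 3 3] sq'[of 4 3] by (simp_all add: matrix_matrix_mult_6 Z algebra_simps)
  have C: "J$5$5 * J$5$5 + J$5$6 * J$6$5 = -1" "J$6$5 * (J$5$5 + J$6$6) = 0"
    using sq'[of 5 5] sq'[of 6 5] by (simp_all add: matrix_matrix_mult_6 Z algebra_simps)
  have D: "J$3$1 * J$1$1 + J$3$2 * J$2$1 + J$3$3 * J$3$1 + J$3$4 * J$4$1 = 0"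
    "J$4$1 * J$1$1 + J$4$2 * J$2$1 + J$4$3 * J$3$1 + J$4$4 * J$4$1 = 0"
    using sq'[of 3 1] sq'[of 4 1] by (simp_all add: matrix_matrix_mult_6 Z)
  have E: "J$5$3 * J$3$3 + J$5$4 * J$4$3 + J$5$5 * J$5$3 + J$5$6 * J$6$3 = 0"
    "J$6$3 * J$3$3 + J$6$4 * J$4$3 + J$6$5 * J$5$3 + J$6$6 * J$6$3 = 0"
    using sq'[of 5 3] sq'[of 6 3] by (simp_all add: matrix_matrix_mult_6 Z)
  have F: "J$5$1 * J$1$1 + J$5$2 * J$2$1 + J$5$3 * J$3$1 + J$5$4 * J$4$1 + J$5$5 * J$5$1 + J$5$6 * J$6$1 = 0"
    "J$6$1 * J$1$1 + J$6$2 * J$2$1 + J$6$3 * J$3$1 + J$6$4 * J$4$1 + J$6$5 * J$5$1 + J$6$6 * J$6$1 = 0"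
    using sq'[of 5 1] sq'[of 6 1] by (simp_all add: matrix_matrix_mult_6)
  \<comment> \<open>A zero here would make the square of a diagonal entry equal to -1.\<close>
  have nz: "J$2$1 \<noteq> 0" "J$4$3 \<noteq> 0" "J$6$5 \<noteq> 0"
    using A(1) B(1) C(1) no by auto
  have N13: "(G68 (J *v bv 1) (J *v bv 3) - G68 (bv 1) (bv 3) - J *v G68 (J *v bv 1) (bv 3)
      - J *v G68 (bv 1) (J *v bv 3)) $ i = 0" for i
    by (simp add: N)
  \<comment> \<open>In the notation of \<open>normal_matrix\<close>, after division: e/f = a/c + b/d
    and 1/f = 1/c + 1/d, which is the addition of eigenvectors
    \<open>\<alpha> + \<beta>\<close>.\<close>
  have G: "(J$2$1 + J$4$3) * J$5$5 = J$1$1 * J$4$3 + J$3$3 * J$2$1"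
    "(J$2$1 + J$4$3) * J$6$5 = J$2$1 * J$4$3"
    using N13[of 5] N13[of 6]
    by (simp_all add: matrix_vector_mult_6[of J "G68 _ _"] G68_nth Z bv_nth matrix_vector_mult_bv algebra_simps)
  have cd: "J$2$1 + J$4$3 \<noteq> 0"
    using G(2) nz by auto
  then show "J \<in> chart_domain"
    using nz by (simp add: chart_domain_def)
  have e: "(J$1$1 * J$4$3 + J$3$3 * J$2$1) / (J$2$1 + J$4$3) = J$5$5"
    and f: "J$2$1 * J$4$3 / (J$2$1 + J$4$3) = J$6$5"
    using G cd by (simp_all add: nonzero_divide_eq_eq mult.commute)
  have d: "J$2$2 = - J$1$1" "J$4$4 = - J$3$3" "J$6$6 = - J$5$5"
    using A(2) B(2) C(2) nz by simp_all
  have u: "- (((J$1$1)^2 + 1) / J$2$1) = J$1$2" "- (((J$3$3)^2 + 1) / J$4$3) = J$3$4"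
    "- (((J$5$5)^2 + 1) / J$6$5) = J$5$6"
    using A(1) B(1) C(1) nz by (simp_all add: field_simps power2_eq_square)
  have p: "- (((J$1$1 + J$3$3) * J$3$1 + J$3$4 * J$4$1) / J$2$1) = J$3$2"
    "- ((J$4$3 * J$3$1 + (J$1$1 - J$3$3) * J$4$1) / J$2$1) = J$4$2"
    using D nz by (simp_all add: d field_simps)
  have q: "- (((J$3$3 + J$5$5) * J$5$3 + J$5$6 * J$6$3) / J$4$3) = J$5$4"
    "- ((J$6$5 * J$5$3 + (J$3$3 - J$5$5) * J$6$3) / J$4$3) = J$6$4"
    using E nz by (simp_all add: d field_simps)
  have r: "- ((J$5$3 * J$3$1 + J$5$4 * J$4$1 + (J$1$1 + J$5$5) * J$5$1 + J$5$6 * J$6$1) / J$2$1) = J$5$2"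
    "- ((J$6$3 * J$3$1 + J$6$4 * J$4$1 + J$6$5 * J$5$1 + (J$1$1 - J$5$5) * J$6$1) / J$2$1) = J$6$2"
    using F nz by (simp_all add: d field_simps)
  show "J = normal_form_of J"
    unfolding normal_form_of_def normal_matrix_def Let_def e f u p q r
    by (simp add: vec_eq_iff forall_6 Z d)
qed

section \<open>Reduction to \<open>J68\<close>\<close>

text \<open>For \<open>J = normal_matrix a c b d \<dots>\<close> the columns \<open>y\<^sub>1, \<dots>, y\<^sub>6\<close> are forced by the shape of
  \<open>J68 b \<kappa>\<close>, \<open>\<kappa> = d/c\<close>, once \<open>y\<^sub>1 = x\<^sub>1\<close> is chosen: \<open>y\<^sub>2 = J y\<^sub>1 + (b/\<kappa>) y\<^sub>1\<close>, \<open>y\<^sub>4 = [y\<^sub>1, y\<^sub>2]\<close>,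
  \<open>J y\<^sub>3 = b y\<^sub>3 + \<kappa> y\<^sub>4\<close>, \<open>y\<^sub>5 = [y\<^sub>1, y\<^sub>4]\<close>, \<open>y\<^sub>6 = [y\<^sub>2, y\<^sub>4]\<close>.\<close>

definition adapted_basis :: "real \<Rightarrow> real \<Rightarrow> real \<Rightarrow> real \<Rightarrow> real \<Rightarrow> real \<Rightarrow> real \<Rightarrow> real \<Rightarrow> real^6^6" where
  "adapted_basis m c p\<^sub>3 p\<^sub>4 r\<^sub>5 r\<^sub>6 s t = vector [
     vector [1, m, 0, 0, 0, 0],
     vector [0, c, 0, 0, 0, 0],
     vector [0, p\<^sub>3, 1, 0, 0, 0],
     vector [0, p\<^sub>4, 0, c, 0, 0],
     vector [0, r\<^sub>5, s, p\<^sub>4, c, m * c],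
     vector [0, r\<^sub>6, t, 0, 0, c * c]]"

text \<open>In the order 2, 1, 3, 4, 6, 5 of the coordinates the matrix is triangular with nonzero
  diagonal, so its kernel vanishes row by row.\<close>

lemma adapted_basis_Aut:
  assumes "c \<noteq> 0"
  shows "adapted_basis m c p\<^sub>3 p\<^sub>4 r\<^sub>5 r\<^sub>6 s t \<in> Aut G68"
proof -
  let ?\<Phi> = "adapted_basis m c p\<^sub>3 p\<^sub>4 r\<^sub>5 r\<^sub>6 s t"
  have "x = 0" if "?\<Phi> *v x = 0" for x
  proof -
    have *: "(?\<Phi> *v x) $ i = 0" for i by (simp add: that)
    note rows = *[unfolded matrix_vector_mult_6 adapted_basis_def]
    have "x$2 = 0" using rows[of 2] assms by simp
    moreover from this have "x$1 = 0" "x$3 = 0" "x$4 = 0"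
      using rows[of 1] rows[of 3] rows[of 4] assms by simp_all
    moreover from calculation have "x$6 = 0" using rows[of 6] assms by simp
    moreover from calculation have "x$5 = 0" using rows[of 5] assms by simp
    ultimately show "x = 0" by (simp add: vec_eq_iff forall_6)
  qed
  then have "invertible ?\<Phi>"
    by (simp add: invertible_left_inverse matrix_left_invertible_ker)
  moreover have "?\<Phi> *v G68 X Y = G68 (?\<Phi> *v X) (?\<Phi> *v Y)" for X Y
    by (simp add: vec_eq_iff forall_6 matrix_vector_mult_6 G68_nth adapted_basis_def algebra_simps)
  ultimately show ?thesis by (simp add: Aut_def)
qed

text \<open>Only the central part \<open>s\<close>, \<open>t\<close> of y_3 remains to be found. The
  equation for J y_3 is a linear system for it with determinant b^2 + 1, hence solvable.\<close>

lemma normal_matrix_adapted_basis: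
  fixes a b c d :: real
  assumes nz: "c \<noteq> 0" "d \<noteq> 0" "c + d \<noteq> 0"
  shows "\<exists>\<Phi>\<in>Aut G68. normal_matrix a c b d p\<^sub>3 p\<^sub>4 q\<^sub>5 q\<^sub>6 r\<^sub>5 r\<^sub>6 ** \<Phi> = \<Phi> ** J68 b (d / c)"
proof -
  define e where "e = (a * d + b * c) / (c + d)"
  define f where "f = c * d / (c + d)"
  define u where "u = - ((a^2 + 1) / c)"
  define v where "v = - ((b^2 + 1) / d)"
  define w where "w = - ((e^2 + 1) / f)"
  define p\<^sub>3' where "p\<^sub>3' = - (((a + b) * p\<^sub>3 + v * p\<^sub>4) / c)"
  define p\<^sub>4' where "p\<^sub>4' = - ((d * p\<^sub>3 + (a - b) * p\<^sub>4) / c)"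
  define q\<^sub>5' where "q\<^sub>5' = - (((b + e) * q\<^sub>5 + w * q\<^sub>6) / d)"
  define q\<^sub>6' where "q\<^sub>6' = - ((f * q\<^sub>5 + (b - e) * q\<^sub>6) / d)"
  define r\<^sub>5' where "r\<^sub>5' = - ((q\<^sub>5 * p\<^sub>3 + q\<^sub>5' * p\<^sub>4 + (a + e) * r\<^sub>5 + w * r\<^sub>6) / c)"
  define r\<^sub>6' where "r\<^sub>6' = - ((q\<^sub>6 * p\<^sub>3 + q\<^sub>6' * p\<^sub>4 + f * r\<^sub>5 + (a - e) * r\<^sub>6) / c)"
  define N where "N = normal_matrix a c b d p\<^sub>3 p\<^sub>4 q\<^sub>5 q\<^sub>6 r\<^sub>5 r\<^sub>6"
  have N: "N = vector [
       vector [a, u, 0, 0, 0, 0],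
       vector [c, - a, 0, 0, 0, 0],
       vector [p\<^sub>3, p\<^sub>3', b, v, 0, 0],
       vector [p\<^sub>4, p\<^sub>4', d, - b, 0, 0],
       vector [r\<^sub>5, r\<^sub>5', q\<^sub>5, q\<^sub>5', e, w],
       vector [r\<^sub>6, r\<^sub>6', q\<^sub>6, q\<^sub>6', f, - e]]"
    unfolding N_def normal_matrix_def Let_def e_def f_def u_def v_def w_def p\<^sub>3'_def p\<^sub>4'_def
      q\<^sub>5'_def q\<^sub>6'_def r\<^sub>5'_def r\<^sub>6'_def by (rule refl)
  \<comment> \<open>The quotients in \<open>J68 b k\<close> get names, and \<open>m\<close> is the
    x_1-coordinate of y_2 = N x_1 + n x_1. The products \<open>d = k * c\<close>,
    \<open>b = n * k\<close>, \<open>k * g = b^2 + 1\<close>, \<open>h * l = 1\<close> then replace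
    division.\<close>
  define k where "k = d / c"
  define n where "n = b / k"
  define g where "g = (b^2 + 1) / k"
  define h where "h = (k + 1) / k"
  define l where "l = k / (k + 1)"
  define m where "m = a + n"
  have k0: "k \<noteq> 0" and k1: "k + 1 \<noteq> 0"
    using nz by (auto simp: k_def field_simps)
  have d: "d = k * c" and b: "b = n * k" and g: "k * g = b^2 + 1" and hl: "h * l = 1"
    using nz k0 k1 by (simp_all add: k_def n_def g_def h_def l_def)
  have cd: "c + d = c * (k + 1)"
    by (simp add: d algebra_simps)
  have e: "e = l * m"
    using nz k0 k1 unfolding e_def cd by (simp add: d b l_def m_def field_simps)
  have f: "f = l * c"
    using nz k1 unfolding f_def cd by (simp add: d l_def)
  have J68: "J68 b (d / c) = vector [
     vector [- n, - (1 + n^2), 0, 0,   0, 0],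
     vector [1,   n,           0, 0,   0, 0],
     vector [0,   0,           b, - g, 0, 0],
     vector [0,   0,           k, - b, 0, 0],
     vector [0,   0,           0, 0,   0, - h],
     vector [0,   0,           0, 0,   l, 0]]"
    unfolding J68_def k_def[symmetric]
    using k0 by (simp add: n_def g_def h_def l_def power_divide add_divide_distrib)
  have l0: "l \<noteq> 0" using hl by auto
  \<comment> \<open>The definitions with denominators cleared, so that what remains is polynomial
    algebra.\<close>
  have R: "c * u = - (a^2 + 1)" "c * v = - g" "c * w = - (l * m^2 + h)"
    "c * p\<^sub>3' = - ((a + b) * p\<^sub>3 + v * p\<^sub>4)" "c * p\<^sub>4' = - (d * p\<^sub>3 + (a - b) * p\<^sub>4)"
    "k * c * q\<^sub>5' = - ((b + e) * q\<^sub>5 + w * q\<^sub>6)" "k * c * q\<^sub>6' = - (f * q\<^sub>5 + (b - e) * q\<^sub>6)"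
    "c * r\<^sub>5' = - (q\<^sub>5 * p\<^sub>3 + q\<^sub>5' * p\<^sub>4 + (a + e) * r\<^sub>5 + w * r\<^sub>6)"
    "c * r\<^sub>6' = - (q\<^sub>6 * p\<^sub>3 + q\<^sub>6' * p\<^sub>4 + f * r\<^sub>5 + (a - e) * r\<^sub>6)"
  proof -
    show "c * u = - (a^2 + 1)" using nz by (simp add: u_def)
    show "c * v = - g" using nz k0 by (simp add: v_def d g_def)
    have "l * (c * w) = - (e^2 + 1)"
      using nz l0 by (simp add: w_def f)
    also have "\<dots> = l * (- (l * m^2 + h))"
      using hl unfolding e by algebra
    finally show "c * w = - (l * m^2 + h)"
      using l0 by simp
    show "c * p\<^sub>3' = - ((a + b) * p\<^sub>3 + v * p\<^sub>4)" "c * p\<^sub>4' = - (d * p\<^sub>3 + (a - b) * p\<^sub>4)"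
      using nz unfolding p\<^sub>3'_def p\<^sub>4'_def by simp_all
    show "k * c * q\<^sub>5' = - ((b + e) * q\<^sub>5 + w * q\<^sub>6)" "k * c * q\<^sub>6' = - (f * q\<^sub>5 + (b - e) * q\<^sub>6)"
      using nz unfolding q\<^sub>5'_def q\<^sub>6'_def d[symmetric] by simp_all
    show "c * r\<^sub>5' = - (q\<^sub>5 * p\<^sub>3 + q\<^sub>5' * p\<^sub>4 + (a + e) * r\<^sub>5 + w * r\<^sub>6)"
      "c * r\<^sub>6' = - (q\<^sub>6 * p\<^sub>3 + q\<^sub>6' * p\<^sub>4 + f * r\<^sub>5 + (a - e) * r\<^sub>6)"
      using nz unfolding r\<^sub>5'_def r\<^sub>6'_def by simp_all
  qed
  have wf: "w * f = - (e^2 + 1)"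
    using R(3) hl unfolding e f by algebra
  have b2: "b^2 + 1 \<noteq> 0"
    using zero_le_power2[of b] by linarith
  \<comment> \<open>Read off from the central coordinates of N y_4 = - g y_3 - b y_4, where
    \<open>s\<close> and \<open>t\<close> occur separately; the system for N y_3 is checked
    afterwards in \<open>S1\<close> and \<open>S2\<close>.\<close>
  define s where "s = - (k * (c * q\<^sub>5' + p\<^sub>4 * (e + b)) / (b^2 + 1))"
  define t where "t = - (k * (c * q\<^sub>6' + p\<^sub>4 * f) / (b^2 + 1))"
  have "(b^2 + 1) * s = - (k * (c * q\<^sub>5' + p\<^sub>4 * (e + b)))"
    "(b^2 + 1) * t = - (k * (c * q\<^sub>6' + p\<^sub>4 * f))"
    using b2 by (simp_all add: s_def t_def)
  then have st: "(b^2 + 1) * s = (b + e) * q\<^sub>5 + w * q\<^sub>6 - k * p\<^sub>4 * (e + b)"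
    "(b^2 + 1) * t = f * q\<^sub>5 + (b - e) * q\<^sub>6 - k * p\<^sub>4 * f"
    using R(6,7) by algebra+
  have "(b^2 + 1) * (q\<^sub>5 + (e - b) * s + w * t) = (b^2 + 1) * (k * p\<^sub>4)"
    "(b^2 + 1) * (q\<^sub>6 + f * s) = (b^2 + 1) * ((e + b) * t)"
    using st wf by algebra+
  then have S1: "q\<^sub>5 + (e - b) * s + w * t = k * p\<^sub>4" and S2: "q\<^sub>6 + f * s = (e + b) * t"
    using b2 by (metis mult_cancel_left)+
  have "k * (q\<^sub>5' * c + e * p\<^sub>4) = k * (- g * s - b * p\<^sub>4)" "k * (q\<^sub>6' * c + f * p\<^sub>4) = k * (- g * t)"
    using st R(6,7) g by algebra+
  then have S3: "q\<^sub>5' * c + e * p\<^sub>4 = - g * s - b * p\<^sub>4" and S4: "q\<^sub>6' * c + f * p\<^sub>4 = - g * t"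
    using k0 by (metis mult_cancel_left)+
  let ?A = "adapted_basis m c p\<^sub>3 p\<^sub>4 r\<^sub>5 r\<^sub>6 s t"
  \<comment> \<open>The entries of the matrix equation, written exactly as they stand once zero
    terms and factors 1 are removed, so that they match syntactically below.\<close>
  have entries:
    "a = - n + m"
    "a * m + u * c = - (1 + n^2) + m * n"
    "c * m + - a * c = c * n"
    "p\<^sub>3 * m + p\<^sub>3' * c + b * p\<^sub>3 + v * p\<^sub>4 = p\<^sub>3 * n"
    "v * c = - g"
    "p\<^sub>4 * m + p\<^sub>4' * c + d * p\<^sub>3 + - b * p\<^sub>4 = p\<^sub>4 * n"
    "d = c * k"
    "- b * c = c * - b"
    "r\<^sub>5 * m + r\<^sub>5' * c + q\<^sub>5 * p\<^sub>3 + q\<^sub>5' * p\<^sub>4 + e * r\<^sub>5 + w * r\<^sub>6 = r\<^sub>5 * n"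
    "q\<^sub>5 + e * s + w * t = s * b + p\<^sub>4 * k"
    "q\<^sub>5' * c + e * p\<^sub>4 = s * - g + p\<^sub>4 * - b"
    "e * c = m * c * l"
    "e * (m * c) + w * (c * c) = c * - h"
    "r\<^sub>6 * m + r\<^sub>6' * c + q\<^sub>6 * p\<^sub>3 + q\<^sub>6' * p\<^sub>4 + f * r\<^sub>5 + - e * r\<^sub>6 = r\<^sub>6 * n"
    "q\<^sub>6 + f * s + - e * t = t * b"
    "q\<^sub>6' * c + f * p\<^sub>4 = t * - g"
    "f * c = c * c * l"
    "f * (m * c) + - e * (c * c) = 0"
    subgoal using m_def by simp
    subgoal using R(1) m_def by algebra
    subgoal using m_def by algebra
    subgoal using R(4) m_def by algebra
    subgoal using R(2) by algebra
    subgoal using R(5) m_def by algebra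
    subgoal using d by simp
    subgoal by simp
    subgoal using R(8) m_def by algebra
    subgoal using S1 by algebra
    subgoal using S3 by algebra
    subgoal using e by algebra
    subgoal using R(3) e by algebra
    subgoal using R(9) m_def by algebra
    subgoal using S2 by algebra
    subgoal using S4 by algebra
    subgoal using f by algebra
    subgoal using e f by algebra
    done
  have "\<forall>i j. (N ** ?A) $ i $ j = (?A ** J68 b (d / c)) $ i $ j"
    unfolding forall_6 N J68 matrix_matrix_mult_6 adapted_basis_def vector_6
      mult_zero_left mult_zero_right add_0_left add_0_right mult_1_left mult_1_right
    by (intro conjI) (rule refl entries)+
  then show ?thesis
    unfolding N_def[symmetric] using adapted_basis_Aut[OF nz(1)] by (blast intro!: vec_eq_iff[THEN iffD2])
qed

section \<open>Automorphisms and the uniqueness of the parameters\<close>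

lemma Aut_G68_entries:
  assumes "\<Phi> \<in> Aut G68"
  shows "\<Phi>$2$1 = 0" "\<Phi>$4$3 = 0" "\<Phi>$2$4 = 0" "\<Phi>$3$4 = 0"
    "\<Phi>$3$3 = \<Phi>$1$1 * \<Phi>$1$1" "\<Phi>$4$4 = \<Phi>$1$1 * \<Phi>$2$2"
    "\<Phi>$1$1 \<noteq> 0" "\<Phi>$2$2 \<noteq> 0"
    "\<Phi>$2$3 = 0" "\<Phi>$2$5 = 0" "\<Phi>$2$6 = 0"
    "\<Phi>$3$5 = 0" "\<Phi>$3$6 = 0" "\<Phi>$4$5 = 0" "\<Phi>$4$6 = 0"
proof -
  \<comment> \<open>The columns of \<open>\<Phi>\<close> satisfy the bracket relations of the basis.
    The relations are used in the order that first puts column 4 into the derived algebra and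
    columns 5 and 6 into the centre.\<close>
  have "G68 (\<Phi> *v bv i) (\<Phi> *v bv j) = \<Phi> *v G68 (bv i) (bv j)" for i j
    using assms by (simp add: Aut_def)
  then have E: "G68 (\<Phi> *v bv i) (\<Phi> *v bv j) $ k = (\<Phi> *v G68 (bv i) (bv j)) $ k" for i j k
    by simp
  have E12: "\<Phi>$k$4 = G68 (\<Phi> *v bv 1) (\<Phi> *v bv 2) $ k"
    and E14: "\<Phi>$k$5 = G68 (\<Phi> *v bv 1) (\<Phi> *v bv 4) $ k"
    and E24: "\<Phi>$k$6 = G68 (\<Phi> *v bv 2) (\<Phi> *v bv 4) $ k"
    and E23: "\<Phi>$k$5 = G68 (\<Phi> *v bv 2) (\<Phi> *v bv 3) $ k"
    and E13: "G68 (\<Phi> *v bv 1) (\<Phi> *v bv 3) $ k = 0"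
    and E34: "G68 (\<Phi> *v bv 3) (\<Phi> *v bv 4) $ k = 0" for k
    unfolding E by (simp_all add: G68_basis matrix_vector_mult_bv)
  show z4: "\<Phi>$2$4 = 0" "\<Phi>$3$4 = 0"
    using E12[of 2] E12[of 3] by (simp_all add: G68_nth)
  have z14: "\<Phi>$1$4 = 0" using E12[of 1] by (simp add: G68_nth)
  show "\<Phi>$2$5 = 0" "\<Phi>$2$6 = 0" "\<Phi>$3$5 = 0" "\<Phi>$3$6 = 0" "\<Phi>$4$5 = 0" "\<Phi>$4$6 = 0"
    using E14[of 2] E24[of 2] E14[of 3] E24[of 3] E14[of 4] E24[of 4]
    by (simp_all add: G68_nth matrix_vector_mult_bv z4 z14)
  have z15: "\<Phi>$1$5 = 0" "\<Phi>$2$5 = 0" "\<Phi>$3$5 = 0" "\<Phi>$4$5 = 0"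
    using E14[of 1] E14[of 2] E14[of 3] E14[of 4] by (simp_all add: G68_nth matrix_vector_mult_bv z4 z14)
  define k where "k = \<Phi>$4$4"
  have k: "k = \<Phi>$1$1 * \<Phi>$2$2 - \<Phi>$2$1 * \<Phi>$1$2"
    using E12[of 4] by (simp add: k_def G68_nth matrix_vector_mult_bv)
  have y5: "\<Phi>$5$5 = \<Phi>$1$1 * k" "\<Phi>$6$5 = \<Phi>$2$1 * k"
    using E14[of 5] E14[of 6] by (simp_all add: k_def G68_nth matrix_vector_mult_bv z4 z14)
  \<comment> \<open>With k = 0, column 5 would vanish, against invertibility.\<close>
  have k0: "k \<noteq> 0"
  proof
    assume "k = 0"
    then have "\<Phi> *v bv 5 = \<Phi> *v 0"
      using z15 y5 by (simp add: vec_eq_iff forall_6 matrix_vector_mult_bv)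
    moreover obtain \<Psi> where "\<Psi> ** \<Phi> = mat 1"
      using assms by (blast elim: Aut_inverse)
    ultimately have "bv 5 = 0"
      by (metis matrix_vector_mul_assoc matrix_vector_mul_lid)
    then show False by simp
  qed
  have z3: "\<Phi>$1$3 = 0" "\<Phi>$2$3 = 0"
    using E34[of 5] E34[of 6] k0 by (simp_all add: k_def G68_nth matrix_vector_mult_bv z4 z14)
  then show "\<Phi>$2$3 = 0" by simp
  have e13: "\<Phi>$1$1 * \<Phi>$4$3 + \<Phi>$2$1 * \<Phi>$3$3 = 0" "\<Phi>$2$1 * \<Phi>$4$3 = 0"
    using E13[of 5] E13[of 6] by (simp_all add: G68_nth matrix_vector_mult_bv z3)
  have e23: "\<Phi>$1$2 * \<Phi>$4$3 + \<Phi>$2$2 * \<Phi>$3$3 = \<Phi>$1$1 * k" "\<Phi>$2$2 * \<Phi>$4$3 = \<Phi>$2$1 * k"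
    using E23[of 5] E23[of 6] y5 by (simp_all add: G68_nth matrix_vector_mult_bv z3)
  \<comment> \<open>If this entry were nonzero, the relation for (x_1, x_3) would give
    \<open>\<Phi>$4$3 = 0\<close>, and then [x_2, x_3] = [x_1, x_4] would give
    \<open>\<Phi>$2$1 * k = 0\<close>.\<close>
  show z21: "\<Phi>$2$1 = 0"
    using e13(2) e23(2) k0 by auto
  with k k0 show nz: "\<Phi>$1$1 \<noteq> 0" "\<Phi>$2$2 \<noteq> 0" by auto
  then show "\<Phi>$4$3 = 0" using e13 z21 by simp
  then show "\<Phi>$3$3 = \<Phi>$1$1 * \<Phi>$1$1"
    using e23(1) nz by (simp add: k z21 algebra_simps)
  show "\<Phi>$4$4 = \<Phi>$1$1 * \<Phi>$2$2"
    using k z21 by (simp add: k_def)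
qed

text \<open>Entry (2, 1) gives \<open>\<Phi>$1$1 = \<Phi>$2$2\<close>, so the diagonal entries at
  x_3 and x_4 coincide; entries (3, 3) and (4, 3) then compare \<open>b\<close> and \<open>c\<close>
  with a common nonzero factor.\<close>

lemma J68_orbit_unique:
  assumes "J68 b' c' \<in> orbit G68 (J68 b c)"
  shows "b' = b" "c' = c"
proof -
  obtain \<Phi> where \<Phi>: "\<Phi> \<in> Aut G68" and eq: "J68 b c ** \<Phi> = \<Phi> ** J68 b' c'"
    using assms by (auto simp: mem_orbit_iff)
  note A = Aut_G68_entries[OF \<Phi>]
  have eq': "(J68 b c ** \<Phi>) $ i $ j = (\<Phi> ** J68 b' c') $ i $ j" for i j
    by (simp add: eq)
  have 1: "\<Phi>$1$1 = \<Phi>$2$2"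
    using eq'[of 2 1] by (simp add: matrix_matrix_mult_6 J68_def A(1-4,9-))
  show "b' = b"
    using eq'[of 3 3] A(5,7) by (simp add: matrix_matrix_mult_6 J68_def A(1-4,9-))
  show "c' = c"
    using eq'[of 4 3] A(5-8) 1 by (simp add: matrix_matrix_mult_6 J68_def A(1-4,9-))
qed

section \<open>The set of complex structures\<close>

lemma J68_complex_structure:
  assumes "c \<noteq> 0" "c \<noteq> -1"
  shows "J68 b c \<in> complex_structures G68"
  using J68_square[of c b] J68_nijenhuis[of c b] assms by (simp add: complex_structures_def add_eq_0_iff2)

lemma normal_form_orbit:
  assumes "J \<in> chart_domain" "J = normal_form_of J"
  obtains b c where "c \<noteq> 0" "c \<noteq> -1" "J68 b c \<in> orbit G68 J"
proof
  \<comment> \<open>The value -1 of \<open>?c\<close> is excluded because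
    \<open>J$2$1 + J$4$3\<close> is nonzero.\<close>
  let ?b = "J$3$3" and ?c = "J$4$3 / J$2$1"
  have nz: "J$2$1 \<noteq> 0" "J$4$3 \<noteq> 0" "J$2$1 + J$4$3 \<noteq> 0"
    using assms(1) by (auto simp: chart_domain_def)
  then show "?c \<noteq> 0" "?c \<noteq> -1"
    by (auto simp: field_simps)
  have "\<exists>\<Phi>\<in>Aut G68. normal_form_of J ** \<Phi> = \<Phi> ** J68 ?b ?c"
    unfolding normal_form_of_def by (rule normal_matrix_adapted_basis[OF nz])
  then show "J68 ?b ?c \<in> orbit G68 J"
    using assms(2) by (simp add: mem_orbit_iff)
qed

text \<open>A fixed point of the normal form needs no integrability computation of its own: it lies
  in the orbit of some \<open>J68 b c\<close>, and orbits preserve complex structures.\<close>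

lemma complex_structures_G68_eq:
  "complex_structures G68 = {J \<in> chart_domain. J = normal_form_of J}"
proof (intro equalityI subsetI CollectI conjI)
  fix J assume "J \<in> {J \<in> chart_domain. J = normal_form_of J}"
  then obtain b c where "c \<noteq> 0" "c \<noteq> -1" "J68 b c \<in> orbit G68 J"
    using normal_form_orbit by blast
  then show "J \<in> complex_structures G68"
    using J68_complex_structure orbit_subset_complex_structures orbit_sym by blast
qed (use complex_structure_normal in blast)+

section \<open>The smooth graph of dimension 10\<close>

lemma open_chart_domain: "open chart_domain"
  unfolding chart_domain_def by (intro open_Collect_conj open_Collect_neq continuous_intros)

lemma smooth_on_entry: "open S \<Longrightarrow> smooth_on (\<lambda>J. J $ i $ j) (S :: (real^'n^'m) set)"
  by (intro smooth_on_bounded_linear[where L = "\<lambda>v. v $ j"] smooth_on_bounded_linear[where L = "\<lambda>v. v $ i"]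
      bounded_linear_vec_nth smooth_on_id)

lemma smooth_on_normal_form: "smooth_on (\<lambda>J. normal_form_of J $ i $ j) chart_domain"
proof -
  let ?U = "chart_domain"
  note U = open_chart_domain
  note S = smooth_on_entry smooth_on_const smooth_on_minus smooth_on_add smooth_on_diff
    smooth_on_mult smooth_on_divide U
  \<comment> \<open>These follow the \<open>let\<close> of \<open>normal_matrix\<close>, with
    squares as products, and are proved smooth in order of dependence.\<close>
  define e where "e = (\<lambda>J::real^6^6. (J$1$1 * J$4$3 + J$3$3 * J$2$1) / (J$2$1 + J$4$3))"
  define f where "f = (\<lambda>J::real^6^6. J$2$1 * J$4$3 / (J$2$1 + J$4$3))"
  define u where "u = (\<lambda>J::real^6^6. - ((J$1$1 * J$1$1 + 1) / J$2$1))"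
  define v where "v = (\<lambda>J::real^6^6. - ((J$3$3 * J$3$3 + 1) / J$4$3))"
  define w where "w = (\<lambda>J. - ((e J * e J + 1) / f J))"
  define p\<^sub>3' where "p\<^sub>3' = (\<lambda>J. - (((J$1$1 + J$3$3) * J$3$1 + v J * J$4$1) / J$2$1))"
  define p\<^sub>4' where "p\<^sub>4' = (\<lambda>J::real^6^6. - ((J$4$3 * J$3$1 + (J$1$1 - J$3$3) * J$4$1) / J$2$1))"
  define q\<^sub>5' where "q\<^sub>5' = (\<lambda>J. - (((J$3$3 + e J) * J$5$3 + w J * J$6$3) / J$4$3))"
  define q\<^sub>6' where "q\<^sub>6' = (\<lambda>J. - ((f J * J$5$3 + (J$3$3 - e J) * J$6$3) / J$4$3))"
  define r\<^sub>5' where "r\<^sub>5' = (\<lambda>J. - ((J$5$3 * J$3$1 + q\<^sub>5' J * J$4$1 + (J$1$1 + e J) * J$5$1 + w J * J$6$1) / J$2$1))"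
  define r\<^sub>6' where "r\<^sub>6' = (\<lambda>J. - ((J$6$3 * J$3$1 + q\<^sub>6' J * J$4$1 + f J * J$5$1 + (J$1$1 - e J) * J$6$1) / J$2$1))"
  have nz: "J$2$1 \<noteq> 0" "J$4$3 \<noteq> 0" "J$2$1 + J$4$3 \<noteq> 0" "f J \<noteq> 0" if "J \<in> ?U" for J
    using that by (auto simp: chart_domain_def f_def)
  have 1: "smooth_on e ?U" "smooth_on f ?U" "smooth_on u ?U" "smooth_on v ?U" "smooth_on p\<^sub>4' ?U"
    unfolding e_def f_def u_def v_def p\<^sub>4'_def by (intro S; simp add: nz)+
  have 2: "smooth_on w ?U" "smooth_on p\<^sub>3' ?U"
    unfolding w_def p\<^sub>3'_def by (intro S 1; simp add: nz)+
  have 3: "smooth_on q\<^sub>5' ?U" "smooth_on q\<^sub>6' ?U"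
    unfolding q\<^sub>5'_def q\<^sub>6'_def by (intro S 1 2; simp add: nz)+
  have 4: "smooth_on r\<^sub>5' ?U" "smooth_on r\<^sub>6' ?U"
    unfolding r\<^sub>5'_def r\<^sub>6'_def by (intro S 1 2 3; simp add: nz)+
  have N: "normal_form_of J = vector [
       vector [J$1$1, u J, 0, 0, 0, 0],
       vector [J$2$1, - J$1$1, 0, 0, 0, 0],
       vector [J$3$1, p\<^sub>3' J, J$3$3, v J, 0, 0],
       vector [J$4$1, p\<^sub>4' J, J$4$3, - J$3$3, 0, 0],
       vector [J$5$1, r\<^sub>5' J, J$5$3, q\<^sub>5' J, e J, w J],
       vector [J$6$1, r\<^sub>6' J, J$6$3, q\<^sub>6' J, f J, - e J]]" for J
    unfolding normal_form_of_def normal_matrix_def Let_def power2_eq_square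
      r\<^sub>5'_def r\<^sub>6'_def q\<^sub>5'_def q\<^sub>6'_def p\<^sub>3'_def p\<^sub>4'_def w_def v_def u_def e_def f_def by (rule refl)
  have "\<forall>i j. smooth_on (\<lambda>J. normal_form_of J $ i $ j) ?U"
    unfolding forall_6 N vector_6 by (intro conjI S 1 2 3 4)
  then show ?thesis by blast
qed

text \<open>The coordinates on the graph: column 1, and column 3 below its first two entries, which
  vanish on complex structures.\<close>

definition free_entries :: "(6 \<times> 6) set" where
  "free_entries = {(1, 1), (2, 1), (3, 1), (4, 1), (5, 1), (6, 1), (3, 3), (4, 3), (5, 3), (6, 3)}"

lemma normal_form_of_free_entries: "(i, j) \<in> free_entries \<Longrightarrow> normal_form_of J $ i $ j = J $ i $ j"
  by (auto simp: free_entries_def normal_form_of_def normal_matrix_def Let_def)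

lemma normal_form_of_cong:
  assumes "\<And>i j. (i, j) \<in> free_entries \<Longrightarrow> J $ i $ j = K $ i $ j"
  shows "normal_form_of J = normal_form_of K" "J \<in> chart_domain \<longleftrightarrow> K \<in> chart_domain"
  using assms unfolding normal_form_of_def chart_domain_def free_entries_def by simp_all

lemma submanifold_complex_structures_G68: "submanifold 10 (complex_structures G68)"
proof -
  define E where "E = (\<lambda>(i, j). axis i (axis j 1) :: real^6^6)"
  define B where "B = E ` free_entries"
  \<comment> \<open>The dependent part of the normal form; it is zero at the free positions, as a
    graph over \<open>span B\<close> requires.\<close>
  define h :: "real^6^6 \<Rightarrow> real^6^6" where
    "h J = (\<chi> i j. if (i, j) \<in> free_entries then 0 else normal_form_of J $ i $ j)" for J
  have E: "J \<bullet> E (i, j) = J $ i $ j" for J i j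
    by (simp add: E_def inner_axis)
  have Basis: "Basis = range E"
    by (auto simp: Basis_vec_def E_def)
  have "inj E"
    by (rule injI) (auto simp: E_def axis_eq_axis)
  then have "card B = card free_entries" and EB: "E x \<in> B \<longleftrightarrow> x \<in> free_entries" for x
    by (auto simp: B_def card_image inj_on_subset inj_image_mem_iff)
  then have "card B = 10"
    by (simp add: free_entries_def)
  have "B \<subseteq> Basis"
    by (auto simp: B_def Basis)
  have "smooth_on h chart_domain"
  proof (rule smooth_on_componentwise[OF open_chart_domain])
    fix b :: "real^6^6" assume "b \<in> Basis"
    then obtain i j where b: "b = E (i, j)" by (auto simp: Basis)
    show "smooth_on (\<lambda>J. h J \<bullet> b) chart_domain"
      by (cases "(i, j) \<in> free_entries")
        (simp_all add: b E h_def smooth_on_const open_chart_domain smooth_on_normal_form)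
  qed
  then have "submanifold 10 {J \<in> chart_domain. J - h J \<in> span B}"
  proof (rule submanifold_graph[OF open_chart_domain _ \<open>B \<subseteq> Basis\<close> \<open>card B = 10\<close>])
    show "h J \<bullet> b = 0" if "b \<in> B" for J b
      using that by (auto simp: B_def E h_def)
    fix J K :: "real^6^6" assume "\<And>b. b \<in> B \<Longrightarrow> J \<bullet> b = K \<bullet> b"
    then have JK: "J $ i $ j = K $ i $ j" if "(i, j) \<in> free_entries" for i j
      using that by (metis E EB)
    from normal_form_of_cong[OF this] show "h J = h K" "J \<in> chart_domain \<Longrightarrow> K \<in> chart_domain"
      by (simp_all only: h_def)
  qed
  moreover have "J - h J \<in> span B \<longleftrightarrow> J = normal_form_of J" for J
  proof -
    have "Basis - B = E ` (- free_entries)"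
      unfolding Basis B_def using image_set_diff[OF \<open>inj E\<close>, of UNIV free_entries]
      by (simp add: Compl_eq_Diff_UNIV)
    then have "J - h J \<in> span B \<longleftrightarrow> (\<forall>x\<in>- free_entries. (J - h J) \<bullet> E x = 0)"
      by (simp add: mem_span_subset_Basis[OF \<open>B \<subseteq> Basis\<close>])
    also have "\<dots> \<longleftrightarrow> (\<forall>i j. (i, j) \<notin> free_entries \<longrightarrow> J $ i $ j = normal_form_of J $ i $ j)"
    proof -
      have "(J - h J) \<bullet> E (i, j) = J $ i $ j - normal_form_of J $ i $ j" if "(i, j) \<notin> free_entries" for i j
        using that by (simp add: E h_def)
      then show ?thesis by auto
    qed
    \<comment> \<open>At the free positions the normal form always agrees with
      \<open>J\<close>.\<close>
    also have "\<dots> \<longleftrightarrow> J = normal_form_of J"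
      by (metis normal_form_of_free_entries vec_eq_iff)
    finally show ?thesis .
  qed
  ultimately show ?thesis
    by (simp add: complex_structures_G68_eq)
qed

theorem mainTheorem7:
  shows
    "(\<forall>J \<in> complex_structures G68. \<exists>b c. c \<noteq> 0 \<and> c \<noteq> -1 \<and> equivalent G68 J (J68 b c))
   \<and> (\<forall>b c b' c'. c \<noteq> 0 \<longrightarrow> c \<noteq> -1 \<longrightarrow> c' \<noteq> 0 \<longrightarrow> c' \<noteq> -1 \<longrightarrow>
        (equivalent G68 (J68 b c) (J68 b' c') \<longleftrightarrow> b = b' \<and> c = c'))
   \<and> submanifold 10 (complex_structures G68)
   \<and> complex_structures G68 = (\<Union>(b, c) \<in> UNIV \<times> (UNIV - {0, -1}). orbit G68 (J68 b c))
   \<and> disjoint_family_on (\<lambda>(b, c). orbit G68 (J68 b c)) (UNIV \<times> (UNIV - {0, -1}))"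
proof (intro conjI ballI allI impI)
  have classification: "\<exists>b c. c \<noteq> 0 \<and> c \<noteq> -1 \<and> J68 b c \<in> orbit G68 J"
    if "J \<in> complex_structures G68" for J
    using normal_form_orbit[OF complex_structure_normal[OF that]] by blast
  then show "\<exists>b c. c \<noteq> 0 \<and> c \<noteq> -1 \<and> equivalent G68 J (J68 b c)"
    if "J \<in> complex_structures G68" for J
    using that by (simp add: equivalent_def)
  show "equivalent G68 (J68 b c) (J68 b' c') \<longleftrightarrow> b = b' \<and> c = c'" for b c b' c'
    unfolding equivalent_def using J68_orbit_unique[of b' c' b c] orbit_refl[of "J68 b c"] by auto
  show "submanifold 10 (complex_structures G68)"
    by (rule submanifold_complex_structures_G68)
  show "complex_structures G68 = (\<Union>(b, c) \<in> UNIV \<times> (UNIV - {0, -1}). orbit G68 (J68 b c))"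
  proof (intro equalityI subsetI)
    fix J assume "J \<in> complex_structures G68"
    then obtain b c where "c \<noteq> 0" "c \<noteq> -1" "J68 b c \<in> orbit G68 J"
      using classification by blast
    then show "J \<in> (\<Union>(b, c) \<in> UNIV \<times> (UNIV - {0, -1}). orbit G68 (J68 b c))"
      using orbit_sym by (intro UN_I[of "(b, c)"]) auto
  next
    fix J assume "J \<in> (\<Union>(b, c) \<in> UNIV \<times> (UNIV - {0, -1}). orbit G68 (J68 b c))"
    then obtain b c where "c \<noteq> 0" "c \<noteq> -1" "J \<in> orbit G68 (J68 b c)"
      by auto
    then show "J \<in> complex_structures G68"
      using orbit_subset_complex_structures[OF J68_complex_structure] by blast
  qed
  have "b' = b \<and> c' = c" if "J \<in> orbit G68 (J68 b c)" "J \<in> orbit G68 (J68 b' c')" for J b c b' c'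
    using J68_orbit_unique[OF orbit_trans[OF that(1) orbit_sym[OF that(2)]]] by blast
  then show "disjoint_family_on (\<lambda>(b, c). orbit G68 (J68 b c)) (UNIV \<times> (UNIV - {0, -1}))"
    unfolding disjoint_family_on_def by (simp add: disjoint_iff split_beta) (metis prod.collapse)
qed

end
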